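(* Let $\alpha\in(0,1)$ and let $\rho_{AB}$ be a state on $\mathbb{C}_A\otimes\mathbb{C}_B$. Then $C_\alpha$ is invariant under local unitary operations: for all unitary operators $U_A$ on $\mathbb{C}_A$ and $U_B$ on $\mathbb{C}_B$, $$C_\alpha(\rho_{AB})=C_\alpha\big((U_A\otimes U_B)\,\rho_{AB}\,(U_A^\dagger\otimes U_B^\dagger)\big).$$
   Context: All Hilbert spaces are finite-dimensional complex Hilbert spaces. A state is a positive semidefinite operator of trace one. Quantum $\alpha$-Rényi entropy: $S_\alpha(\rho)=\frac{1}{1-\alpha}\log\mathrm{Tr}(\rho^\alpha)$. $\alpha$-quantum Jensen-Shannon divergence of an ensemble $\xi=\{p_k,\rho_k\}_k$ of states: $Q_\alpha(\xi)=S_\alpha\big(\sum_k p_k\rho_k\big)-\sum_k p_kS_\alpha(\rho_k)$. For a POVM $M_B=\{M_x\}_x$ on $B$ (finitely many positive semidefinite operators summing to the identity), let $\xi_{AB}^{M_B}=\{p_x,\rho_x^A\}_x$, where $p_x\rho_x^A=\mathrm{Tr}_B\big((\mathbb{I}_A\otimes M_x)\rho_{AB}\big)$ and $p_x$ is the trace of this operator (terms with $p_x=0$ are dropped). Define $C_\alpha(\rho_{AB})=\sup_{M_B}Q_\alpha(\xi_{AB}^{M_B})$, the supremum being over all POVMs on $B$. *)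

theory Defs
  imports "HOL-Analysis.Analysis"
begin

text \<open>
  A system with finite index type \<open>'a\<close> has the Hilbert space \<open>complex^'a\<close>;
  operators are matrices with respect to an orthonormal basis. The composite of systems \<open>'a\<close> and
  \<open>'b\<close> is indexed by \<open>'a \<times> 'b\<close>.
\<close>

definition adj :: "complex^'n^'m \<Rightarrow> complex^'m^'n" where
  "adj A = (\<chi> i j. cnj (A $ j $ i))"

definition unitary :: "complex^'n^'n \<Rightarrow> bool" where
  "unitary U \<longleftrightarrow> adj U ** U = mat 1 \<and> U ** adj U = mat 1"

definition psd :: "complex^'n^'n \<Rightarrow> bool" where
  "psd A \<longleftrightarrow> (\<forall>v :: complex^'n. (\<Sum>i\<in>UNIV. cnj (v $ i) * (A *v v) $ i) \<in> \<real>\<^sub>\<ge>\<^sub>0)"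

definition state :: "complex^'n^'n \<Rightarrow> bool" where
  "state \<rho> \<longleftrightarrow> psd \<rho> \<and> trace \<rho> = 1"

definition diag :: "('n \<Rightarrow> real) \<Rightarrow> complex^'n^'n" where
  "diag d = (\<chi> i j. if i = j then complex_of_real (d i) else 0)"

text \<open>
  Real power of a positive semidefinite matrix by functional calculus. The result does not depend
  on the chosen spectral decomposition. For \<open>a > 0\<close> the kernel is mapped to zero, as \<open>0 powr a = 0\<close>.
\<close>
definition mpowr :: "complex^'n^'n \<Rightarrow> real \<Rightarrow> complex^'n^'n" where
  "mpowr A a = (THE B. \<exists>U d. unitary U \<and> (\<forall>i. 0 \<le> d i) \<and> A = U ** diag d ** adj U \<and>
     B = U ** diag (\<lambda>i. d i powr a) ** adj U)"

text \<open>The logarithm is the natural one. The trace below is real, so \<open>Re\<close> only changes its type.\<close>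
definition renyi_entropy :: "real \<Rightarrow> complex^'n^'n \<Rightarrow> real" where
  "renyi_entropy \<alpha> \<rho> = 1 / (1 - \<alpha>) * ln (Re (trace (mpowr \<rho> \<alpha>)))"

text \<open>Ensembles are lists of pairs \<open>(p\<^sub>k, \<rho>\<^sub>k)\<close>, so that repeated entries are allowed.\<close>
definition jensen_shannon :: "real \<Rightarrow> (real \<times> (complex^'n^'n)) list \<Rightarrow> real" where
  "jensen_shannon \<alpha> \<xi> = renyi_entropy \<alpha> (\<Sum>(p, \<rho>)\<leftarrow>\<xi>. p *\<^sub>R \<rho>)
     - (\<Sum>(p, \<rho>)\<leftarrow>\<xi>. p * renyi_entropy \<alpha> \<rho>)"

definition tensor :: "complex^'a^'a \<Rightarrow> complex^'b^'b \<Rightarrow> complex^('a::finite \<times> 'b::finite)^('a \<times> 'b)" where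
  "tensor A B = (\<chi> x y. A $ fst x $ fst y * B $ snd x $ snd y)"

definition ptrace_B :: "complex^('a::finite \<times> 'b::finite)^('a \<times> 'b) \<Rightarrow> complex^'a^'a" where
  "ptrace_B X = (\<chi> i j. \<Sum>k\<in>UNIV. X $ (i, k) $ (j, k))"

definition povm :: "(complex^'b^'b) list \<Rightarrow> bool" where
  "povm Ms \<longleftrightarrow> (\<forall>M\<in>set Ms. psd M) \<and> sum_list Ms = mat 1"

definition unnormalized_post :: "complex^('a::finite \<times> 'b::finite)^('a \<times> 'b) \<Rightarrow> complex^'b^'b \<Rightarrow> complex^'a^'a" where
  "unnormalized_post \<rho> M = ptrace_B (tensor (mat 1) M ** \<rho>)"

definition outcome_prob :: "complex^('a::finite \<times> 'b::finite)^('a \<times> 'b) \<Rightarrow> complex^'b^'b \<Rightarrow> real" where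
  "outcome_prob \<rho> M = Re (trace (unnormalized_post \<rho> M))"

definition measured_ensemble ::
  "complex^('a::finite \<times> 'b::finite)^('a \<times> 'b) \<Rightarrow> (complex^'b^'b) list \<Rightarrow> (real \<times> (complex^'a^'a)) list" where
  "measured_ensemble \<rho> Ms =
     map (\<lambda>M. (outcome_prob \<rho> M, (1 / outcome_prob \<rho> M) *\<^sub>R unnormalized_post \<rho> M))
       (filter (\<lambda>M. outcome_prob \<rho> M \<noteq> 0) Ms)"

text \<open>
  The supremum is a real one. For a state and \<open>\<alpha> \<in> (0,1)\<close> it is over a nonempty set that is bounded
  above by the entropy of the reduced state on \<open>'a\<close>, since entropies of states are nonnegative.
\<close>
definition C :: "real \<Rightarrow> complex^('a::finite \<times> 'b::finite)^('a \<times> 'b) \<Rightarrow> real" where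
  "C \<alpha> \<rho> = (SUP Ms\<in>{Ms. povm Ms}. jensen_shannon \<alpha> (measured_ensemble \<rho> Ms))"

end

theory Submission
  imports Defs
begin

text \<open>
  Conjugating the state by \<open>U\<^sub>A \<otimes> U\<^sub>B\<close> and measuring \<open>{M\<^sub>x}\<close> gives the ensemble obtained from the
  original state with the POVM \<open>{U\<^sub>B\<^sup>\<dagger> M\<^sub>x U\<^sub>B}\<close>, conjugated by \<open>U\<^sub>A\<close>. The entropy is invariant
  under conjugation, and \<open>M \<mapsto> U\<^sub>B\<^sup>\<dagger> M U\<^sub>B\<close> permutes the POVMs, so both suprema range over the
  same set of values.
\<close>

definition conjugate :: "complex^'n^'n \<Rightarrow> complex^'n^'n \<Rightarrow> complex^'n^'n" where
  "conjugate U X = U ** X ** adj U"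

lemma adj_adj [simp]: "adj (adj A) = A"
  by (simp add: adj_def vec_eq_iff)

lemma adj_mult: "adj (A ** B) = adj B ** adj A"
  by (simp add: adj_def vec_eq_iff matrix_matrix_mult_def mult.commute)

lemma unitary_adj: "unitary U \<Longrightarrow> unitary (adj U)"
  by (simp add: unitary_def)

lemma unitary_mult: "unitary U \<Longrightarrow> unitary V \<Longrightarrow> unitary (U ** V)"
  unfolding unitary_def adj_mult by (metis matrix_mul_assoc matrix_mul_rid)

lemma conjugate_conjugate: "conjugate U (conjugate V X) = conjugate (U ** V) X"
  by (simp add: conjugate_def adj_mult matrix_mul_assoc)

lemma conjugate_mat_1 [simp]: "conjugate (mat 1) X = X"
  by (simp add: conjugate_def adj_def matrix_mul_assoc matrix_matrix_mult_def vec_eq_iff mat_def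
      if_distrib[of cnj] if_distrib[of "\<lambda>x. x * _"] if_distrib[of "\<lambda>x. _ * x"] cong: if_cong)

lemma conjugate_adj_cancel:
  assumes "unitary U"
  shows "conjugate (adj U) (conjugate U X) = X" "conjugate U (conjugate (adj U) X) = X"
  using assms by (simp_all add: conjugate_conjugate unitary_def)

lemma conjugate_unitary_mat_1: "unitary U \<Longrightarrow> conjugate U (mat 1) = mat 1"
  by (simp add: conjugate_def unitary_def)

lemma conjugate_0 [simp]: "conjugate U 0 = 0"
  by (simp add: conjugate_def matrix_matrix_mult_def vec_eq_iff)

lemma conjugate_add: "conjugate U (X + Y) = conjugate U X + conjugate U Y"
  by (simp add: conjugate_def matrix_matrix_mult_def vec_eq_iff sum.distrib distrib_left distrib_right)

lemma conjugate_scaleR: "conjugate U (c *\<^sub>R X) = c *\<^sub>R conjugate U X"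
  by (simp add: conjugate_def matrix_matrix_mult_def vec_eq_iff scaleR_sum_right sum_distrib_right)

lemma conjugate_sum_list: "conjugate U (sum_list Xs) = (\<Sum>X\<leftarrow>Xs. conjugate U X)"
  by (induction Xs) (simp_all add: conjugate_add)

lemma trace_conjugate: "unitary U \<Longrightarrow> trace (conjugate U X) = trace X"
  by (metis conjugate_def matrix_mul_assoc matrix_mul_lid trace_mul_sym unitary_def)

text \<open>The quadratic form of \<open>conjugate U M\<close> at \<open>v\<close> is that of
  \<open>M\<close> at \<open>adj U *v v\<close>.\<close>

lemma psd_conjugate:
  assumes "psd M"
  shows "psd (conjugate U M)"
proof -
  have "(\<Sum>i\<in>UNIV. cnj (v $ i) * (U *v w) $ i) = (\<Sum>i\<in>UNIV. cnj ((adj U *v v) $ i) * w $ i)"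
    for v w
    by (simp add: adj_def matrix_vector_mult_def sum_distrib_left sum_distrib_right mult_ac)
      (rule sum.swap)
  with assms show ?thesis
    by (simp add: psd_def conjugate_def flip: matrix_vector_mul_assoc)
qed

lemma povm_conjugate:
  assumes "unitary U" "povm Ms"
  shows "povm (map (conjugate U) Ms)"
  using assms by (auto simp: povm_def psd_conjugate conjugate_unitary_mat_1 simp flip: conjugate_sum_list)

text \<open>This makes the \<open>THE\<close> in \<open>mpowr\<close> well defined. The change of
  basis \<open>W\<close> between the two decompositions has nonzero entries only where the
  eigenvalues agree, and there \<open>f\<close> agrees too.\<close>

lemma spectral_calculus_unique:
  fixes f :: "real \<Rightarrow> real"
  assumes U: "unitary U" and V: "unitary V"
    and eq: "conjugate U (diag d) = conjugate V (diag e)"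
  shows "conjugate U (diag (\<lambda>i. f (d i))) = conjugate V (diag (\<lambda>i. f (e i)))"
proof -
  define W where "W = adj V ** U"
  have W: "unitary W"
    unfolding W_def using U V by (intro unitary_mult unitary_adj)
  have intertwine: "conjugate W X = Y \<longleftrightarrow> W ** X = Y ** W" for X Y
    using W unfolding conjugate_def unitary_def by (metis matrix_mul_assoc matrix_mul_rid)
  \<comment> \<open>Right multiplication by a diagonal matrix scales columns, left multiplication
    scales rows.\<close>
  have entry: "W ** diag x = diag y ** W \<longleftrightarrow> (\<forall>i j. W $ i $ j * x j = y i * W $ i $ j)" for x y
    by (simp add: matrix_matrix_mult_def diag_def vec_eq_iff if_distrib[of "\<lambda>x. x * _"]
        if_distrib[of "\<lambda>x. _ * x"] cong: if_cong)
  \<comment> \<open>Conjugating both sides by \<open>adj V\<close> leaves \<open>W\<close> on one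
    side only.\<close>
  have transfer: "conjugate U X = conjugate V Y \<longleftrightarrow> conjugate W X = Y" for X Y
    unfolding W_def using conjugate_adj_cancel[OF V] by (metis conjugate_conjugate)
  have "W $ i $ j * d j = e i * W $ i $ j" for i j
    using eq by (simp add: transfer intertwine entry)
  then have "W $ i $ j = 0 \<or> d j = e i" for i j
    by (metis mult.commute mult_cancel_left of_real_eq_iff)
  then have "W $ i $ j * f (d j) = f (e i) * W $ i $ j" for i j
    by (metis mult.commute mult_zero_left)
  then show ?thesis
    by (simp add: transfer intertwine entry)
qed

text \<open>The predicate under \<open>THE\<close> in \<open>mpowr\<close>, as a relation whose
  behaviour under conjugation can be stated.\<close>

definition powr_rel :: "real \<Rightarrow> complex^'n^'n \<Rightarrow> complex^'n^'n \<Rightarrow> bool" where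
  "powr_rel a A B \<longleftrightarrow> (\<exists>U d. unitary U \<and> (\<forall>i. 0 \<le> d i) \<and> A = conjugate U (diag d) \<and>
     B = conjugate U (diag (\<lambda>i. d i powr a)))"

lemma mpowr_eq_The: "mpowr A a = The (powr_rel a A)"
  by (simp add: mpowr_def powr_rel_def[abs_def] conjugate_def)

lemma mpowr_eqI: "powr_rel a A B \<Longrightarrow> mpowr A a = B"
  unfolding mpowr_eq_The
  by (rule the_equality) (auto simp: powr_rel_def intro: spectral_calculus_unique)

text \<open>The unitary \<open>U\<close> is absorbed into the diagonalizing one; the eigenvalues
  stay the same.\<close>

lemma powr_rel_conjugate:
  assumes "unitary U" "powr_rel a A B"
  shows "powr_rel a (conjugate U A) (conjugate U B)"
  using assms unfolding powr_rel_def by (metis conjugate_conjugate unitary_mult)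

text \<open>
  No spectral theorem is needed: if \<open>A\<close> had no spectral decomposition, neither would its conjugate,
  and both powers would be the same unspecified \<open>THE\<close> value.
\<close>
lemma trace_mpowr_conjugate:
  assumes U: "unitary U"
  shows "trace (mpowr (conjugate U A) a) = trace (mpowr A a)"
proof (cases "\<exists>B. powr_rel a A B")
  case True
  then obtain B where "powr_rel a A B" by blast
  with powr_rel_conjugate[OF U this] show ?thesis
    by (simp add: mpowr_eqI trace_conjugate[OF U])
next
  case False
  moreover have "powr_rel a A (conjugate (adj U) B)" if "powr_rel a (conjugate U A) B" for B
    using powr_rel_conjugate[OF unitary_adj[OF U] that] by (simp add: conjugate_adj_cancel U)
  ultimately have "powr_rel a (conjugate U A) = powr_rel a A"
    by blast
  then show ?thesis
    by (simp add: mpowr_eq_The)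
qed

lemma renyi_entropy_conjugate:
  "unitary U \<Longrightarrow> renyi_entropy \<alpha> (conjugate U \<rho>) = renyi_entropy \<alpha> \<rho>"
  by (simp add: renyi_entropy_def trace_mpowr_conjugate)

text \<open>By linearity, conjugation passes through the mixture, so entropy invariance covers both
  terms.\<close>

lemma jensen_shannon_conjugate:
  assumes "unitary U"
  shows "jensen_shannon \<alpha> (map (\<lambda>(p, \<rho>). (p, conjugate U \<rho>)) \<xi>) = jensen_shannon \<alpha> \<xi>"
proof -
  have "(\<Sum>(p, \<rho>)\<leftarrow>map (\<lambda>(p, \<rho>). (p, conjugate U \<rho>)) \<xi>. p *\<^sub>R \<rho>) =
      conjugate U (\<Sum>(p, \<rho>)\<leftarrow>\<xi>. p *\<^sub>R \<rho>)"
    by (simp add: conjugate_sum_list comp_def case_prod_unfold conjugate_scaleR)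
  then show ?thesis
    by (simp add: jensen_shannon_def renyi_entropy_conjugate assms comp_def case_prod_unfold)
qed

lemma tensor_mult: "tensor A B ** tensor A' B' = tensor (A ** A') (B ** B')"
  by (simp add: tensor_def matrix_matrix_mult_def vec_eq_iff sum_product sum.cartesian_product
      case_prod_unfold mult_ac)

lemma ptrace_B_tensor_left: "ptrace_B (tensor A (mat 1) ** X) = A ** ptrace_B X"
proof -
  \<comment> \<open>The identity on the second factor is a Kronecker delta that collapses the sum
    over its index.\<close>
  have "(tensor A (mat 1) ** X) $ (i, k) $ y = (\<Sum>j\<in>UNIV. A $ i $ j * X $ (j, k) $ y)" for i k y
    by (simp add: tensor_def matrix_matrix_mult_def mat_def sum.cartesian_product'
        if_distrib[of "\<lambda>x. x * _"] if_distrib[of "\<lambda>x. _ * x"] flip: UNIV_Times_UNIV cong: if_cong)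
  then show ?thesis
    by (simp add: ptrace_B_def vec_eq_iff matrix_matrix_mult_def sum_distrib_left) (intro allI sum.swap)
qed

lemma ptrace_B_tensor_right: "ptrace_B (X ** tensor A (mat 1)) = ptrace_B X ** A"
proof -
  have "(X ** tensor A (mat 1)) $ x $ (i, k) = (\<Sum>j\<in>UNIV. X $ x $ (j, k) * A $ j $ i)" for i k x
    by (simp add: tensor_def matrix_matrix_mult_def mat_def sum.cartesian_product'
        if_distrib[of "\<lambda>x. x * _"] if_distrib[of "\<lambda>x. _ * x"] flip: UNIV_Times_UNIV cong: if_cong)
  then show ?thesis
    by (simp add: ptrace_B_def vec_eq_iff matrix_matrix_mult_def sum_distrib_right) (intro allI sum.swap)
qed

text \<open>A partial trace is not cyclic in general, but an operator acting only on the traced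
  factor can be cycled: each entry of the result is an ordinary trace over that factor.\<close>

lemma ptrace_B_cyclic: "ptrace_B (tensor (mat 1) B ** X) = ptrace_B (X ** tensor (mat 1) B)"
proof -
  \<comment> \<open>The delta now sits in the outer index, so \<open>sum.swap\<close> first brings
    it inside.\<close>
  have "(tensor (mat 1) B ** X) $ (i, k) $ y = (\<Sum>l\<in>UNIV. B $ k $ l * X $ (i, l) $ y)" for i k y
    by (simp add: tensor_def matrix_matrix_mult_def mat_def sum.cartesian_product'
        if_distrib[of "\<lambda>x. x * _"] if_distrib[of "\<lambda>x. _ * x"] flip: UNIV_Times_UNIV cong: if_cong)
      (subst sum.swap, simp)
  moreover have "(X ** tensor (mat 1) B) $ x $ (i, k) = (\<Sum>l\<in>UNIV. B $ l $ k * X $ x $ (i, l))" for i k x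
    by (simp add: tensor_def matrix_matrix_mult_def mat_def sum.cartesian_product'
        if_distrib[of "\<lambda>x. x * _"] if_distrib[of "\<lambda>x. _ * x"] flip: UNIV_Times_UNIV cong: if_cong)
      (subst sum.swap, simp add: mult.commute)
  ultimately show ?thesis
    by (simp add: ptrace_B_def vec_eq_iff) (intro allI sum.swap)
qed

lemma unnormalized_post_conjugate:
  "unnormalized_post (tensor U V ** \<rho> ** tensor (adj U) (adj V)) M =
    conjugate U (unnormalized_post \<rho> (conjugate (adj V) M))"
proof -
  \<comment> \<open>\<open>U\<close> commutes past \<open>M\<close>, since they act on different
    factors, and so moves outermost.\<close>
  have "tensor (mat 1) M ** (tensor U V ** \<rho> ** tensor (adj U) (adj V)) =
      tensor U (mat 1) ** (tensor (mat 1) (M ** V) ** \<rho> ** tensor (mat 1) (adj V)) **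
        tensor (adj U) (mat 1)"
    by (metis (no_types) matrix_mul_assoc matrix_mul_lid matrix_mul_rid tensor_mult)
  then have "unnormalized_post (tensor U V ** \<rho> ** tensor (adj U) (adj V)) M =
      conjugate U (ptrace_B (tensor (mat 1) (M ** V) ** \<rho> ** tensor (mat 1) (adj V)))"
    by (simp add: unnormalized_post_def conjugate_def ptrace_B_tensor_left ptrace_B_tensor_right)
  \<comment> \<open>Cycling \<open>adj V\<close> to the front completes
    \<open>adj V ** M ** V\<close>.\<close>
  also have "ptrace_B (tensor (mat 1) (M ** V) ** \<rho> ** tensor (mat 1) (adj V)) =
      unnormalized_post \<rho> (conjugate (adj V) M)"
    by (simp add: unnormalized_post_def conjugate_def matrix_mul_assoc tensor_mult
        flip: ptrace_B_cyclic)
  finally show ?thesis .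
qed

text \<open>Outcome probabilities are traces, which \<open>U\<close> preserves; hence the same
  outcomes are dropped and the normalizations agree.\<close>

lemma measured_ensemble_conjugate:
  assumes "unitary U"
  shows "measured_ensemble (tensor U V ** \<rho> ** tensor (adj U) (adj V)) Ms =
    map (\<lambda>(p, \<sigma>). (p, conjugate U \<sigma>)) (measured_ensemble \<rho> (map (conjugate (adj V)) Ms))"
proof -
  have "outcome_prob (tensor U V ** \<rho> ** tensor (adj U) (adj V)) M =
      outcome_prob \<rho> (conjugate (adj V) M)" for M
    by (simp add: outcome_prob_def unnormalized_post_conjugate trace_conjugate assms)
  then show ?thesis
    by (simp add: measured_ensemble_def unnormalized_post_conjugate conjugate_scaleR filter_map
        comp_def)
qed

lemma image_conjugate_povm:
  fixes U :: "complex^'n^'n"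
  assumes U: "unitary U"
  shows "map (conjugate U) ` {Ms. povm Ms} = {Ms. povm Ms}"
proof (intro equalityI subsetI)
  fix Ms :: "(complex^'n^'n) list"
  assume "Ms \<in> {Ms. povm Ms}"
  then have "map (conjugate (adj U)) Ms \<in> {Ms. povm Ms}"
    by (simp add: povm_conjugate unitary_adj U)
  moreover have "Ms = map (conjugate U) (map (conjugate (adj U)) Ms)"
    by (simp add: comp_def conjugate_adj_cancel U)
  ultimately show "Ms \<in> map (conjugate U) ` {Ms. povm Ms}"
    by (rule rev_image_eqI)
qed (auto simp: povm_conjugate U)

theorem theorem16:
  fixes \<alpha> :: real
    and \<rho> :: "complex^('a::finite \<times> 'b::finite)^('a \<times> 'b)"
    and U\<^sub>A :: "complex^'a^'a"
    and U\<^sub>B :: "complex^'b^'b"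
  assumes "0 < \<alpha>" and "\<alpha> < 1"
    and "state \<rho>"
    and "unitary U\<^sub>A" and "unitary U\<^sub>B"
  shows "C \<alpha> \<rho> = C \<alpha> (tensor U\<^sub>A U\<^sub>B ** \<rho> ** tensor (adj U\<^sub>A) (adj U\<^sub>B))"
proof -
  have "C \<alpha> (tensor U\<^sub>A U\<^sub>B ** \<rho> ** tensor (adj U\<^sub>A) (adj U\<^sub>B)) =
      (SUP Ms\<in>{Ms. povm Ms}. jensen_shannon \<alpha> (measured_ensemble \<rho> (map (conjugate (adj U\<^sub>B)) Ms)))"
    by (simp add: C_def measured_ensemble_conjugate jensen_shannon_conjugate assms)
  \<comment> \<open>Reindexing by the bijection on POVMs keeps the set of values, so the real
    suprema are equal outright.\<close>
  also have "\<dots> = (SUP Ms\<in>map (conjugate (adj U\<^sub>B)) ` {Ms. povm Ms}.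
      jensen_shannon \<alpha> (measured_ensemble \<rho> Ms))"
    by (simp only: image_image)
  also have "\<dots> = C \<alpha> \<rho>"
    by (simp only: image_conjugate_povm[OF unitary_adj[OF assms(5)]] C_def)
  finally show ?thesis ..
qed

end
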